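(* Let $t\geq 1$ and $h\geq\max\{t(t+1),4\}$ be integers, and let $\mathcal{H}={\rm Forb}(C_h^t)$. For $a\in\{0,1,\ldots,t\}$ let $\ell_a=\left\lceil\frac{h}{t+a+1}\right\rceil$. Then for all $p\in[0,1]$, \[ \gamma_{\mathcal{H}}(p)=\min_{a\in\{0,1,\ldots,t\}}\left\{\frac{p(1-p)}{a(1-p)+(\ell_a-1)p}\right\}\quad\text{if } (t+1)\mid h, \] \[ \gamma_{\mathcal{H}}(p)=\min_{a\in\{0,1,\ldots,t\}}\left\{\frac{p}{t+1},\ \frac{p(1-p)}{a(1-p)+(\ell_a-1)p}\right\}\quad\text{if } (t+1)\nmid h. \]
   Context: For positive integers $t,h$, $C_h^t$ is the graph with vertex set $\{1,\ldots,h\}$ in which distinct $i,j$ are adjacent iff their distance in the cycle $C_h$ (i.e. $\min(|i-j|,h-|i-j|)$) is at most $t$. ${\rm Forb}(H)$ is the class of graphs containing no induced copy of $H$. For nonnegative integers $r,s$ and $p\in[0,1]$, let $g_{K(r,s)}(p)=\min\{{\bf x}^T{\bf M}{\bf x}: {\bf x}\in\mathbb{R}^{r+s},{\bf x}\ge 0,\sum_i x_i=1\}$ where ${\bf M}$ is the diagonal matrix with $r$ diagonal entries equal to $p$ and $s$ diagonal entries equal to $1-p$ (so for $p\in(0,1)$, $g_{K(r,s)}(p)=(r/p+s/(1-p))^{-1}$). The clique spectrum $\Gamma(\mathcal{H})$ of $\mathcal{H}={\rm Forb}(H)$ is the set of pairs $(r,s)$ of nonnegative integers such that $V(H)$ cannot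 be partitioned into $r$ independent sets and $s$ cliques (parts allowed to be empty). Define $\gamma_{\mathcal{H}}(p)=\min\{g_{K(r,s)}(p):(r,s)\in\Gamma(\mathcal{H})\}$. Convention: for $a=0$ the term $\frac{p(1-p)}{(\ell_0-1)p}$ is interpreted as $\frac{1-p}{\ell_0-1}$, including at $p=0$. *)

theory Defs
  imports
    Complex_Main
    "HOL-Library.Disjoint_Sets"
    "Graph_Theory.Graph_Theory"
    "Jordan_Normal_Form.Matrix"
begin

text \<open>
  Finite simple graphs are \<open>pair_graph\<close>s: finite digraphs whose set of arcs is a symmetric,
  irreflexive relation on the vertices. An edge joining \<open>u\<close> and \<open>v\<close> is the pair of
  arcs \<open>(u, v)\<close>, \<open>(v, u)\<close>. Graph classes are sets of finite graphs with
  vertices in \<open>nat\<close>; up to isomorphism this covers every finite graph.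
\<close>

definition power_cycle :: "nat \<Rightarrow> nat \<Rightarrow> nat pair_pre_digraph" where
  "power_cycle h t = \<lparr> pverts = {1..h},
     parcs = {(i, j). i \<in> {1..h} \<and> j \<in> {1..h} \<and> i \<noteq> j \<and>
               min \<bar>int i - int j\<bar> (int h - \<bar>int i - int j\<bar>) \<le> int t} \<rparr>"

definition contains_induced :: "'a pair_pre_digraph \<Rightarrow> 'b pair_pre_digraph \<Rightarrow> bool" where
  "contains_induced G H \<longleftrightarrow>
     (\<exists>S \<subseteq> pverts G. digraph_iso (with_proj G \<restriction> S) (with_proj H))"

definition Forb :: "nat pair_pre_digraph \<Rightarrow> nat pair_pre_digraph set" where
  "Forb H = {G. pair_graph G \<and> \<not> contains_induced G H}"

definition independent_in :: "'a pair_pre_digraph \<Rightarrow> 'a set \<Rightarrow> bool" where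
  "independent_in G S \<longleftrightarrow> S \<subseteq> pverts G \<and> (\<forall>u\<in>S. \<forall>v\<in>S. (u, v) \<notin> parcs G)"

definition clique_in :: "'a pair_pre_digraph \<Rightarrow> 'a set \<Rightarrow> bool" where
  "clique_in G S \<longleftrightarrow> S \<subseteq> pverts G \<and> (\<forall>u\<in>S. \<forall>v\<in>S. u \<noteq> v \<longrightarrow> (u, v) \<in> parcs G)"

definition rs_partitionable :: "'a pair_pre_digraph \<Rightarrow> nat \<Rightarrow> nat \<Rightarrow> bool" where
  "rs_partitionable G r s \<longleftrightarrow>
     (\<exists>A :: nat \<Rightarrow> 'a set.
        (\<Union>i\<in>{0..<r+s}. A i) = pverts G \<and> disjoint_family_on A {0..<r+s} \<and>
        (\<forall>i\<in>{0..<r}. independent_in G (A i)) \<and> (\<forall>i\<in>{r..<r+s}. clique_in G (A i)))"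

text \<open>
  The clique spectrum of a class of the form \<open>Forb H\<close>. The choice of \<open>H\<close> is
  immaterial, as \<open>clique_spectrum_Forb\<close> below shows.
\<close>

definition clique_spectrum :: "nat pair_pre_digraph set \<Rightarrow> (nat \<times> nat) set" where
  "clique_spectrum \<H> =
     {(r, s). \<exists>H. pair_graph H \<and> \<H> = Forb H \<and> \<not> rs_partitionable H r s}"

definition M_K :: "nat \<Rightarrow> nat \<Rightarrow> real \<Rightarrow> real mat" where
  "M_K r s p = mat (r + s) (r + s) (\<lambda>(i, j). if i = j then (if i < r then p else 1 - p) else 0)"

definition std_simplex :: "nat \<Rightarrow> real vec set" where
  "std_simplex n = {x \<in> carrier_vec n. 0\<^sub>v n \<le> x \<and> (\<Sum>i<n. x $ i) = 1}"

text \<open>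
  \<open>LEAST\<close> denotes the minimum, where it is attained. The simplex is empty for
  \<open>r = s = 0\<close>, so \<open>g_K 0 0 p\<close> carries no information (the minimum over the empty set
  is infinite). The pair \<open>(0, 0)\<close> does belong to the clique spectrum of every
  \<open>Forb H\<close> with \<open>H\<close> non-null, and is therefore left out in \<open>gamma_class\<close>.
\<close>

definition g_K :: "nat \<Rightarrow> nat \<Rightarrow> real \<Rightarrow> real" where
  "g_K r s p = (LEAST v. \<exists>x \<in> std_simplex (r + s). v = x \<bullet> (M_K r s p *\<^sub>v x))"

definition gamma_class :: "nat pair_pre_digraph set \<Rightarrow> real \<Rightarrow> real" where
  "gamma_class \<H> p =
     (LEAST v. \<exists>(r, s) \<in> clique_spectrum \<H> - {(0, 0)}. v = g_K r s p)"

definition ell :: "nat \<Rightarrow> nat \<Rightarrow> nat \<Rightarrow> int" where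
  "ell h t a = \<lceil>real h / real (t + a + 1)\<rceil>"

text \<open>
  The quotient \<open>p(1-p) / (a(1-p) + (ell a - 1)p)\<close>; for \<open>a = 0\<close> the factor \<open>p\<close> is
  cancelled, also at \<open>p = 0\<close>, where Isabelle's \<open>0 / 0 = 0\<close> would give a wrong value.
\<close>

definition quot_term :: "nat \<Rightarrow> nat \<Rightarrow> real \<Rightarrow> nat \<Rightarrow> real" where
  "quot_term h t p a =
     (if a = 0 then (1 - p) / (of_int (ell h t 0) - 1)
      else p * (1 - p) / (real a * (1 - p) + (of_int (ell h t a) - 1) * p))"

lemma pair_graph_power_cycle: "pair_graph (power_cycle h t)"
proof -
  have "finite (parcs (power_cycle h t))"
    by (rule finite_subset[of _ "{1..h} \<times> {1..h}"]) (auto simp: power_cycle_def)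
  then show ?thesis
    by unfold_locales
      (auto simp: power_cycle_def symmetric_def sym_def arcs_ends_def arc_to_ends_def
        with_proj_def abs_minus_commute)
qed

lemma contains_induced_refl:
  assumes "pair_graph H"
  shows "contains_induced H H"
proof -
  interpret pair_graph H by fact
  let ?f = "\<lparr> iso_verts = id, iso_arcs = id, iso_head = snd, iso_tail = fst \<rparr>"
  have eq: "with_proj H \<restriction> pverts H = with_proj H"
    by (auto simp: with_proj_def induce_subgraph_def dest: in_arcsD1 in_arcsD2)
  have "pre_digraph.digraph_isomorphism (with_proj H) ?f"
    unfolding pre_digraph.digraph_isomorphism_def by (auto intro: wf_digraph_axioms)
  moreover have "with_proj H = app_iso ?f (with_proj H)"
    by (simp add: app_iso_def with_proj_def)
  ultimately have "digraph_iso (with_proj H \<restriction> pverts H) (with_proj H)"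
    unfolding digraph_iso_def eq by blast
  then show ?thesis
    unfolding contains_induced_def by blast
qed

lemma contains_inducedD:
  assumes "contains_induced G H" "pair_graph H"
  obtains f where "inj_on f (pverts H)" "f ` pverts H \<subseteq> pverts G"
    "\<And>u v. u \<in> pverts H \<Longrightarrow> v \<in> pverts H \<Longrightarrow> (u, v) \<in> parcs H \<longleftrightarrow> (f u, f v) \<in> parcs G"
proof -
  from assms(1) obtain S \<phi> where S: "S \<subseteq> pverts G"
    and iso: "pre_digraph.digraph_isomorphism (with_proj G \<restriction> S) \<phi>"
    and H: "with_proj H = app_iso \<phi> (with_proj G \<restriction> S)"
    unfolding contains_induced_def digraph_iso_def by auto
  let ?g = "iso_verts \<phi>"
  have inj: "inj_on ?g S"
    using iso by (simp add: pre_digraph.digraph_isomorphism_def)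
  have V: "pverts H = ?g ` S"
    using arg_cong[OF H, of verts] by (simp add: app_iso_def)
  have tl: "iso_tail \<phi> = fst" and hd: "iso_head \<phi> = snd"
    using arg_cong[OF H, of tail] arg_cong[OF H, of head] by (simp_all add: app_iso_def)
  have arc: "iso_arcs \<phi> (u, v) = (?g u, ?g v)" if "(u, v) \<in> parcs G" "u \<in> S" "v \<in> S" for u v
    using iso that tl hd
    by (auto simp: pre_digraph.digraph_isomorphism_def induce_subgraph_def prod_eq_iff)
  have "parcs H = iso_arcs \<phi> ` {(u, v) \<in> parcs G. u \<in> S \<and> v \<in> S}"
    using arg_cong[OF H, of arcs]
    by (simp add: app_iso_def induce_subgraph_def case_prod_beta')
  then have E: "parcs H = {(?g u, ?g v) |u v. (u, v) \<in> parcs G \<and> u \<in> S \<and> v \<in> S}"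
    using arc by (force simp: image_iff)
  show ?thesis
  proof (rule that[of "the_inv_into S ?g"])
    show "inj_on (the_inv_into S ?g) (pverts H)"
      unfolding V by (rule inj_on_the_inv_into[OF inj])
    show "the_inv_into S ?g ` pverts H \<subseteq> pverts G"
      unfolding V using S by (auto simp: the_inv_into_f_f[OF inj])
  next
    fix u v assume "u \<in> pverts H" "v \<in> pverts H"
    then obtain u' v' where "u = ?g u'" "v = ?g v'" "u' \<in> S" "v' \<in> S" by (auto simp: V)
    then show "(u, v) \<in> parcs H \<longleftrightarrow>
        (the_inv_into S ?g u, the_inv_into S ?g v) \<in> parcs G"
      using inj by (auto simp: E the_inv_into_f_f[OF inj] inj_on_eq_iff)
  qed
qed

lemma rs_partitionable_contains_induced:
  assumes "contains_induced G H" "pair_graph H" "rs_partitionable G r s"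
  shows "rs_partitionable H r s"
proof -
  from contains_inducedD[OF assms(1,2)] obtain f where
    inj: "inj_on f (pverts H)" and sub: "f ` pverts H \<subseteq> pverts G" and
    arc: "\<And>u v. u \<in> pverts H \<Longrightarrow> v \<in> pverts H \<Longrightarrow> (u, v) \<in> parcs H \<longleftrightarrow> (f u, f v) \<in> parcs G"
    by metis
  from assms(3) obtain A :: "nat \<Rightarrow> 'a set" where
    A: "(\<Union>i\<in>{0..<r+s}. A i) = pverts G" "disjoint_family_on A {0..<r+s}"
      "\<forall>i\<in>{0..<r}. independent_in G (A i)" "\<forall>i\<in>{r..<r+s}. clique_in G (A i)"
    unfolding rs_partitionable_def by auto
  let ?B = "\<lambda>i. {u \<in> pverts H. f u \<in> A i}"
  have "(\<Union>i\<in>{0..<r+s}. ?B i) = pverts H"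
  proof (intro equalityI subsetI)
    fix u assume "u \<in> pverts H"
    moreover from this have "f u \<in> (\<Union>i\<in>{0..<r+s}. A i)" using sub A(1) by blast
    ultimately show "u \<in> (\<Union>i\<in>{0..<r+s}. ?B i)" by blast
  qed auto
  moreover have "disjoint_family_on ?B {0..<r+s}"
    using A(2) unfolding disjoint_family_on_def by blast
  moreover have "\<forall>i\<in>{0..<r}. independent_in H (?B i)"
    using A(3) arc by (auto simp: independent_in_def)
  moreover have "\<forall>i\<in>{r..<r+s}. clique_in H (?B i)"
    using A(4) arc inj by (auto simp: clique_in_def inj_on_eq_iff)
  ultimately show ?thesis
    unfolding rs_partitionable_def by (intro exI[of _ ?B]) simp
qed

theorem clique_spectrum_Forb:
  assumes "pair_graph H"
  shows "clique_spectrum (Forb H) = {(r, s). \<not> rs_partitionable H r s}"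
proof -
  have "contains_induced H H'" if "pair_graph H'" "Forb H = Forb H'" for H'
    using that assms contains_induced_refl[OF assms] unfolding Forb_def by blast
  then show ?thesis
    unfolding clique_spectrum_def
    using assms rs_partitionable_contains_induced by blast
qed

end

theory Submission
  imports Defs
begin

text \<open>
  Lower bound on the number of cliques: let \<open>a \<le> t\<close> independent sets and \<open>s\<close> cliques
  partition \<open>C_h^t\<close>. For \<open>h \<ge> 3t + 1\<close> every clique lies in a window of \<open>t + 1\<close> consecutive
  vertices, and among any \<open>a + 1\<close> consecutive vertices one lies in a clique of the partition.
  Extending each window by \<open>a\<close> vertices therefore covers the cycle, so \<open>h \<le> s (t + a + 1)\<close>;
  the only other case is the octahedron \<open>C_6^2\<close>. Conversely, cutting the cycle into blocks of
  almost equal length, with the first \<open>a\<close> vertices of each block distributed over the independent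
  sets and the rest forming a clique, attains the bound; \<open>h \<ge> t (t + 1)\<close> makes the blocks
  long enough. So the maximal elements of the clique spectrum are the pairs \<open>(a, \<ell>_a - 1)\<close>
  and, if \<open>t + 1\<close> does not divide \<open>h\<close>, the pair \<open>(t + 1, 0)\<close>, and \<open>g_K\<close> is antitone.
\<close>

section \<open>Adjacency in powers of cycles\<close>

lemma pverts_power_cycle [simp]: "pverts (power_cycle h t) = {1..h}"
  by (simp add: power_cycle_def)

text \<open>For distinct vertices the two residues are the lengths of the two arcs of the cycle
  between \<open>u\<close> and \<open>v\<close>. This form is invariant under rotation, so later
  arguments can shift vertices without treating the wrap-around at \<open>h\<close>
  separately.\<close>

lemma parcs_power_cycle_iff:
  assumes "u \<in> {1..h}" "v \<in> {1..h}"
  shows "(u, v) \<in> parcs (power_cycle h t) \<longleftrightarrow>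
    u \<noteq> v \<and> ((int u - int v) mod int h \<le> int t \<or> (int v - int u) mod int h \<le> int t)"
proof -
  have *: "(int v - int u) mod int h = int v - int u \<and>
      (int u - int v) mod int h = int h - (int v - int u)"
    if "u < v" "u \<in> {1..h}" "v \<in> {1..h}" for u v :: nat
  proof
    show "(int v - int u) mod int h = int v - int u"
      using that by (intro mod_pos_pos_trivial) auto
    have "(int u - int v) mod int h = (int u - int v + int h) mod int h" by simp
    also have "\<dots> = int u - int v + int h"
      using that by (intro mod_pos_pos_trivial) auto
    finally show "(int u - int v) mod int h = int h - (int v - int u)" by simp
  qed
  consider "u = v" | "u < v" | "v < u" by linarith
  then show ?thesis
  proof cases
    case 2
    then show ?thesis using assms *[of u v] by (auto simp: power_cycle_def)
  next
    case 3
    then show ?thesis using assms *[of v u] by (auto simp: power_cycle_def)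
  qed (simp add: power_cycle_def)
qed

section \<open>Partitions as vertex colourings\<close>

lemma rs_partitionable_coloring:
  assumes "\<And>v. v \<in> pverts G \<Longrightarrow> \<kappa> v < r + s"
    and "\<And>u v. u \<in> pverts G \<Longrightarrow> v \<in> pverts G \<Longrightarrow> \<kappa> u = \<kappa> v \<Longrightarrow> \<kappa> u < r \<Longrightarrow> (u, v) \<notin> parcs G"
    and "\<And>u v. u \<in> pverts G \<Longrightarrow> v \<in> pverts G \<Longrightarrow> \<kappa> u = \<kappa> v \<Longrightarrow> r \<le> \<kappa> u \<Longrightarrow> u \<noteq> v
           \<Longrightarrow> (u, v) \<in> parcs G"
  shows "rs_partitionable G r s"
  unfolding rs_partitionable_def
  using assms
  by (intro exI[of _ "\<lambda>i. {v \<in> pverts G. \<kappa> v = i}"])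
     (auto simp: disjoint_family_on_def independent_in_def clique_in_def)

lemma rs_partitionable_coloringE:
  assumes "rs_partitionable G r s"
  obtains \<kappa> where "\<And>v. v \<in> pverts G \<Longrightarrow> \<kappa> v < r + s"
    and "\<And>u v. u \<in> pverts G \<Longrightarrow> v \<in> pverts G \<Longrightarrow> \<kappa> u = \<kappa> v \<Longrightarrow> \<kappa> u < r \<Longrightarrow> (u, v) \<notin> parcs G"
    and "\<And>u v. u \<in> pverts G \<Longrightarrow> v \<in> pverts G \<Longrightarrow> \<kappa> u = \<kappa> v \<Longrightarrow> r \<le> \<kappa> u \<Longrightarrow> u \<noteq> v
           \<Longrightarrow> (u, v) \<in> parcs G"
proof -
  from assms obtain A where A: "(\<Union>i\<in>{0..<r+s}. A i) = pverts G"
      "\<forall>i\<in>{0..<r}. independent_in G (A i)" "\<forall>i\<in>{r..<r+s}. clique_in G (A i)"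
    unfolding rs_partitionable_def by auto
  have "\<forall>v\<in>pverts G. \<exists>i. i < r + s \<and> v \<in> A i"
  proof
    fix v assume "v \<in> pverts G"
    then have "v \<in> (\<Union>i\<in>{0..<r+s}. A i)" using A(1) by simp
    then show "\<exists>i. i < r + s \<and> v \<in> A i" by auto
  qed
  then obtain \<kappa> where \<kappa>: "\<And>v. v \<in> pverts G \<Longrightarrow> \<kappa> v < r + s \<and> v \<in> A (\<kappa> v)"
    by metis
  show thesis
  proof (rule that[of \<kappa>])
    fix u v assume uv: "u \<in> pverts G" "v \<in> pverts G" "\<kappa> u = \<kappa> v"
    show "(u, v) \<notin> parcs G" if "\<kappa> u < r"
    proof -
      have "independent_in G (A (\<kappa> u))" using A(2) that by simp
      then show ?thesis using \<kappa>[OF uv(1)] \<kappa>[OF uv(2)] uv(3) by (simp add: independent_in_def)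
    qed
    show "(u, v) \<in> parcs G" if "r \<le> \<kappa> u" "u \<noteq> v"
    proof -
      have "clique_in G (A (\<kappa> u))" using A(3) that \<kappa>[OF uv(1)] by simp
      then show ?thesis
        using \<kappa>[OF uv(1)] \<kappa>[OF uv(2)] uv(3) that(2) by (simp add: clique_in_def)
    qed
  qed (use \<kappa> in blast)
qed

lemma rs_partitionable_mono:
  assumes "rs_partitionable G r s" "r \<le> r'" "s \<le> s'"
  shows "rs_partitionable G r' s'"
proof -
  from assms(1) obtain \<kappa> where \<kappa>: "\<And>v. v \<in> pverts G \<Longrightarrow> \<kappa> v < r + s"
    "\<And>u v. u \<in> pverts G \<Longrightarrow> v \<in> pverts G \<Longrightarrow> \<kappa> u = \<kappa> v \<Longrightarrow> \<kappa> u < r \<Longrightarrow> (u, v) \<notin> parcs G"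
    "\<And>u v. u \<in> pverts G \<Longrightarrow> v \<in> pverts G \<Longrightarrow> \<kappa> u = \<kappa> v \<Longrightarrow> r \<le> \<kappa> u \<Longrightarrow> u \<noteq> v
       \<Longrightarrow> (u, v) \<in> parcs G"
    by (rule rs_partitionable_coloringE) blast
  define c where "c v = (if \<kappa> v < r then \<kappa> v else \<kappa> v + (r' - r))" for v
  show ?thesis
  proof (rule rs_partitionable_coloring[of _ c])
    fix v assume "v \<in> pverts G"
    then show "c v < r' + s'" using \<kappa>(1)[of v] assms(2,3) by (auto simp: c_def)
  next
    fix u v assume uv: "u \<in> pverts G" "v \<in> pverts G" "c u = c v"
    have "\<kappa> u = \<kappa> v" using uv(3) assms(2) by (auto simp: c_def split: if_splits)
    show "(u, v) \<notin> parcs G" if "c u < r'"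
      using \<kappa>(2)[OF uv(1,2)] \<open>\<kappa> u = \<kappa> v\<close> that assms(2) by (auto simp: c_def split: if_splits)
    show "(u, v) \<in> parcs G" if "r' \<le> c u" "u \<noteq> v"
      using \<kappa>(3)[OF uv(1,2)] \<open>\<kappa> u = \<kappa> v\<close> that assms(2) by (auto simp: c_def split: if_splits)
  qed
qed

section \<open>A lower bound on the number of cliques\<close>

text \<open>Relative to a fixed member \<open>w\<close>, every member of the clique has a signed
  offset between \<open>-t\<close> and \<open>t\<close>. The window starts at the member
  \<open>c\<close> of smallest offset; the bound \<open>3 * t + 1 \<le> h\<close> prevents a clique
  from winding around the cycle.\<close>

lemma clique_in_window:
  assumes h: "3 * t + 1 \<le> h" and Q: "Q \<subseteq> {1..h}" "Q \<noteq> {}"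
    and clique: "\<And>u v. u \<in> Q \<Longrightarrow> v \<in> Q \<Longrightarrow> u \<noteq> v \<Longrightarrow> (u, v) \<in> parcs (power_cycle h t)"
  obtains c :: nat where "\<And>v. v \<in> Q \<Longrightarrow> (int v - int c) mod int h \<le> int t"
proof -
  from Q(2) obtain w where w: "w \<in> Q" by blast
  have "\<exists>x. \<bar>x\<bar> \<le> int t \<and> (int v - int w) mod int h = x mod int h" if v: "v \<in> Q" for v
  proof (cases "v = w")
    case True
    then show ?thesis by (intro exI[of _ 0]) simp
  next
    case False
    then consider "(int v - int w) mod int h \<le> int t" | "(int w - int v) mod int h \<le> int t"
      using clique[OF v w] parcs_power_cycle_iff[of v h w t] v w Q(1) by blast
    then show ?thesis
    proof cases
      case 1
      then show ?thesis using h by (intro exI[of _ "(int v - int w) mod int h"]) simp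
    next
      case 2
      have "(int v - int w) mod int h = (- ((int w - int v) mod int h)) mod int h"
        by (simp add: mod_minus_eq)
      then show ?thesis using 2 h by (intro exI[of _ "- ((int w - int v) mod int h)"]) simp
    qed
  qed
  then obtain x where x: "\<And>v. v \<in> Q \<Longrightarrow> \<bar>x v\<bar> \<le> int t"
    "\<And>v. v \<in> Q \<Longrightarrow> (int v - int w) mod int h = x v mod int h"
    by metis
  have fin: "finite Q" using Q(1) finite_subset by blast
  obtain c where c: "c \<in> Q" "\<And>v. v \<in> Q \<Longrightarrow> x c \<le> x v"
    using arg_min_if_finite(1)[OF fin Q(2), of x] arg_min_least[OF fin Q(2), of _ x] by blast
  show thesis
  proof (rule that[of c])
    fix v assume v: "v \<in> Q"
    have "(int v - int c) mod int h = ((int v - int w) mod int h - (int c - int w) mod int h) mod int h"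
      by (simp add: mod_diff_eq)
    also have "\<dots> = (x v - x c) mod int h"
      by (simp add: x(2) v c(1) mod_diff_eq)
    also have "\<dots> = x v - x c"
      using c(2)[OF v] x(1)[OF v] x(1)[OF c(1)] h by (intro mod_pos_pos_trivial) auto
    finally have e: "(int v - int c) mod int h = x v - x c" .
    show "(int v - int c) mod int h \<le> int t"
    proof (cases "v = c")
      case False
      then have "(int v - int c) mod int h \<le> int t \<or> (int c - int v) mod int h \<le> int t"
        using clique[OF v c(1)] parcs_power_cycle_iff[of v h c t] v c(1) Q(1) by blast
      moreover have "(int c - int v) mod int h \<le> int t \<Longrightarrow> x v - x c = 0"
      proof -
        assume a: "(int c - int v) mod int h \<le> int t"
        show "x v - x c = 0"
        proof (rule ccontr)
          assume n: "x v - x c \<noteq> 0"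
          \<comment> \<open>Here \<open>0 < x v - x c \<le> 2 * t\<close>, so the way from
            \<open>v\<close> forward to \<open>c\<close> has length at least
            \<open>h - 2 * t \<ge> t + 1\<close>.\<close>
          have "(int c - int v) mod int h = (- (x v - x c)) mod int h"
            using e by (metis minus_diff_eq mod_minus_eq)
          also have "\<dots> = (int h - (x v - x c)) mod int h"
            by (metis add.commute mod_add_self1 uminus_add_conv_diff)
          also have "\<dots> = int h - (x v - x c)"
            using n c(2)[OF v] x(1)[OF v] x(1)[OF c(1)] h by (intro mod_pos_pos_trivial) auto
          finally show False using a x(1)[OF v] x(1)[OF c(1)] h by linarith
        qed
      qed
      ultimately show ?thesis using e by linarith
    qed simp
  qed
qed

lemma card_window_le:
  "card {v \<in> {1..h}. (int v - c) mod int h \<le> int k} \<le> k + 1"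
proof (cases "h = 0")
  case False
  let ?f = "\<lambda>v::nat. (int v - c) mod int h"
  have "inj_on ?f {v \<in> {1..h}. ?f v \<le> int k}"
  proof (rule inj_onI)
    fix u v assume uv: "u \<in> {v \<in> {1..h}. ?f v \<le> int k}" "v \<in> {v \<in> {1..h}. ?f v \<le> int k}"
      and "?f u = ?f v"
    then have "int h dvd (int u - c) - (int v - c)"
      by (simp only: mod_eq_dvd_iff)
    then have "int h dvd int u - int v" by simp
    moreover have "\<bar>int u - int v\<bar> < int h" using uv by auto
    ultimately have "int u - int v = 0"
      using dvd_imp_le_int[of "int u - int v" "int h"] by linarith
    then show "u = v" by simp
  qed
  moreover have "?f ` {v \<in> {1..h}. ?f v \<le> int k} \<subseteq> {0..int k}"
    using False by auto
  ultimately have "card {v \<in> {1..h}. ?f v \<le> int k} \<le> card {0..int k}"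
    by (intro card_inj_on_le) auto
  then show ?thesis by simp
qed simp

text \<open>The hypotheses on \<open>t\<close> and \<open>h\<close> leave a single case with
  \<open>h \<le> 3 * t\<close>, namely \<open>t = 2\<close>, \<open>h = 6\<close>. There the clique
  \<open>{1, 3, 5}\<close> lies in no window of three consecutive vertices, so the window argument
  is replaced by a direct one.\<close>

lemma octahedron_not_partitionable:
  "\<not> rs_partitionable (power_cycle 6 2) 2 1"
proof
  let ?G = "power_cycle 6 2"
  assume "rs_partitionable ?G 2 1"
  then obtain \<kappa> where \<kappa>: "\<And>v. v \<in> pverts ?G \<Longrightarrow> \<kappa> v < (2::nat) + 1"
    "\<And>u v. u \<in> pverts ?G \<Longrightarrow> v \<in> pverts ?G \<Longrightarrow> \<kappa> u = \<kappa> v \<Longrightarrow> \<kappa> u < 2 \<Longrightarrow> (u, v) \<notin> parcs ?G"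
    "\<And>u v. u \<in> pverts ?G \<Longrightarrow> v \<in> pverts ?G \<Longrightarrow> \<kappa> u = \<kappa> v \<Longrightarrow> 2 \<le> \<kappa> u \<Longrightarrow> u \<noteq> v
       \<Longrightarrow> (u, v) \<in> parcs ?G"
    by (rule rs_partitionable_coloringE) blast
  \<comment> \<open>The only non-adjacent distinct pairs are the antipodal ones, at distance
    3.\<close>
  have arc: "(u, v) \<in> parcs ?G \<longleftrightarrow> u \<noteq> v \<and> u \<noteq> v + 3 \<and> v \<noteq> u + 3"
    if "u \<in> {1..6}" "v \<in> {1..6}" for u v
    using that by (simp add: power_cycle_def min_le_iff_disj) arith
  \<comment> \<open>The clique misses a vertex of each antipodal pair, and three such vertices form a triangle.\<close>
  have "\<exists>y. (y = i \<or> y = i + 3) \<and> \<kappa> y < 2" if i: "i \<in> {1..3}" for i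
  proof (rule ccontr)
    assume "\<nexists>y. (y = i \<or> y = i + 3) \<and> \<kappa> y < 2"
    then have "\<not> \<kappa> i < 2" "\<not> \<kappa> (i + 3) < 2" by blast+
    then have "\<kappa> i = 2" "\<kappa> (i + 3) = 2"
      using \<kappa>(1)[of i] \<kappa>(1)[of "i + 3"] i by auto
    then show False using \<kappa>(3)[of i "i + 3"] arc[of i "i + 3"] i by auto
  qed
  then obtain y where y: "\<And>i. i \<in> {1..3} \<Longrightarrow> (y i = i \<or> y i = i + 3) \<and> \<kappa> (y i) < 2"
    by metis
  have V: "y i \<in> {1..6}" if "i \<in> {1..3}" for i using y[OF that] that by auto
  have "\<kappa> (y i) \<noteq> \<kappa> (y j)" if ij: "i \<in> {1..3}" "j \<in> {1..3}" "i < j" for i j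
  proof -
    have "y i \<noteq> y j \<and> y i \<noteq> y j + 3 \<and> y j \<noteq> y i + 3"
      using y[OF ij(1)] y[OF ij(2)] ij unfolding atLeastAtMost_iff by linarith
    then have "(y i, y j) \<in> parcs ?G" using arc V ij by blast
    then show ?thesis using \<kappa>(2)[of "y i" "y j"] y[OF ij(1)] V[OF ij(1)] V[OF ij(2)]
      unfolding pverts_power_cycle by blast
  qed
  from this[of 1 2] this[of 1 3] this[of 2 3] show False
    using y[of 1] y[of 2] y[of 3] by simp
qed

lemma clique_count_bound_long_cycle:
  assumes h: "3 * t + 1 \<le> h" and a: "a \<le> t"
    and P: "rs_partitionable (power_cycle h t) a s"
  shows "h \<le> s * (t + a + 1)"
proof -
  let ?G = "power_cycle h t"
  from P obtain \<kappa> where \<kappa>: "\<And>v. v \<in> pverts ?G \<Longrightarrow> \<kappa> v < a + s"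
    "\<And>u v. u \<in> pverts ?G \<Longrightarrow> v \<in> pverts ?G \<Longrightarrow> \<kappa> u = \<kappa> v \<Longrightarrow> \<kappa> u < a \<Longrightarrow> (u, v) \<notin> parcs ?G"
    "\<And>u v. u \<in> pverts ?G \<Longrightarrow> v \<in> pverts ?G \<Longrightarrow> \<kappa> u = \<kappa> v \<Longrightarrow> a \<le> \<kappa> u \<Longrightarrow> u \<noteq> v
       \<Longrightarrow> (u, v) \<in> parcs ?G"
    by (rule rs_partitionable_coloringE) blast
  have "\<exists>c::nat. \<forall>v\<in>{1..h}. \<kappa> v = i \<longrightarrow> (int v - int c) mod int h \<le> int t" if i: "a \<le> i" for i
  proof (cases "{v \<in> {1..h}. \<kappa> v = i} = {}")
    case False
    have "(u, v) \<in> parcs ?G"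
      if "u \<in> {v \<in> {1..h}. \<kappa> v = i}" "v \<in> {v \<in> {1..h}. \<kappa> v = i}" "u \<noteq> v" for u v
      using \<kappa>(3)[of u v] that i by simp
    then obtain c where "\<And>v. v \<in> {v \<in> {1..h}. \<kappa> v = i} \<Longrightarrow> (int v - int c) mod int h \<le> int t"
      using clique_in_window[OF h _ False] by blast
    then show ?thesis by blast
  qed blast
  then obtain c :: "nat \<Rightarrow> nat" where
    c: "\<And>i v. a \<le> i \<Longrightarrow> v \<in> {1..h} \<Longrightarrow> \<kappa> v = i \<Longrightarrow> (int v - int (c i)) mod int h \<le> int t"
    by metis
  have "{1..h} \<subseteq> (\<Union>i\<in>{a..<a+s}. {v \<in> {1..h}. (int v - int (c i)) mod int h \<le> int (t + a)})"
  proof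
    fix v assume v: "v \<in> {1..h}"
    \<comment> \<open>The vertices \<open>v, v - 1, \<dots>, v - a\<close> form a clique, so \<open>a\<close> independent sets cannot cover them.\<close>
    define u where "u d = nat ((int v - int d - 1) mod int h) + 1" for d :: nat
    \<comment> \<open>\<open>u d\<close> is the vertex \<open>d\<close> steps before
      \<open>v\<close>. Subtracting 1 before the reduction and adding it afterwards gives labels in
      \<open>1..h\<close> instead of \<open>0..h-1\<close>.\<close>
    have u: "u d \<in> {1..h}" "int (u d) mod int h = (int v - int d) mod int h" for d
    proof -
      have m: "0 \<le> (int v - int d - 1) mod int h" "(int v - int d - 1) mod int h < int h"
        using h by auto
      then show "u d \<in> {1..h}" unfolding u_def by auto
      have "int (u d) = (int v - int d - 1) mod int h + 1" unfolding u_def using m by simp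
      then show "int (u d) mod int h = (int v - int d) mod int h" by (simp add: mod_simps)
    qed
    have diff: "(int (u d) - int (u e)) mod int h = int e - int d" if "d \<le> e" "e \<le> a" for d e
    proof -
      have "(int (u d) - int (u e)) mod int h = ((int v - int d) - (int v - int e)) mod int h"
        using u(2) by (metis mod_diff_eq)
      also have "\<dots> = (int e - int d) mod int h" by simp
      also have "\<dots> = int e - int d"
        using that a h by (intro mod_pos_pos_trivial) auto
      finally show ?thesis .
    qed
    have neq: "u d \<noteq> u e" if "d < e" "e \<le> a" for d e
      using diff[of d e] that by auto
    have adj: "(u d, u e) \<in> parcs ?G" if "d < e" "e \<le> a" for d e
      using diff[of d e] neq[OF that] that a parcs_power_cycle_iff[OF u(1) u(1)] by auto
    have "\<exists>d\<le>a. a \<le> \<kappa> (u d)"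
    proof (rule ccontr)
      assume "\<not> (\<exists>d\<le>a. a \<le> \<kappa> (u d))"
      then have lt: "\<And>d. d \<le> a \<Longrightarrow> \<kappa> (u d) < a" by (meson not_le)
      then have "(\<lambda>d. \<kappa> (u d)) ` {0..a} \<subseteq> {0..<a}" by auto
      then have "card ((\<lambda>d. \<kappa> (u d)) ` {0..a}) \<le> card {0..<a}" by (intro card_mono) auto
      then have "\<not> inj_on (\<lambda>d. \<kappa> (u d)) {0..a}" using card_image by fastforce
      then obtain d e where "d < e" "e \<le> a" "\<kappa> (u d) = \<kappa> (u e)"
        unfolding inj_on_def by (metis atLeastAtMost_iff linorder_neqE_nat)
      then show False using adj[of d e] \<kappa>(2)[of "u d" "u e"] lt u(1) by auto
    qed
    then obtain d where d: "d \<le> a" "a \<le> \<kappa> (u d)" by blast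
    define i where "i = \<kappa> (u d)"
    let ?m = "(int (u d) - int (c i)) mod int h"
    have m: "?m \<le> int t" using c[OF d(2)] u(1) by (simp add: i_def)
    \<comment> \<open>From \<open>c i\<close> it takes at most \<open>t\<close> steps to reach
      \<open>u d\<close>, and \<open>d \<le> a\<close> more to reach \<open>v\<close>.\<close>
    have "(int v - int (c i)) mod int h = ((int v - int d) mod int h + (int d - int (c i))) mod int h"
      by (simp add: mod_add_left_eq)
    also have "\<dots> = (int (u d) + (int d - int (c i))) mod int h"
      by (simp add: u(2)[symmetric] mod_add_left_eq)
    also have "\<dots> = (?m + int d) mod int h"
      by (subst mod_add_left_eq) (simp add: algebra_simps)
    also have "\<dots> \<le> ?m + int d" using h by (intro zmod_le_nonneg_dividend) auto
    finally have "(int v - int (c i)) mod int h \<le> int (t + a)" using m d(1) by simp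
    moreover have "i \<in> {a..<a+s}" using d(2) \<kappa>(1)[of "u d"] u(1) by (simp add: i_def)
    ultimately show "v \<in> (\<Union>i\<in>{a..<a+s}. {v \<in> {1..h}. (int v - int (c i)) mod int h \<le> int (t + a)})"
      using v by blast
  qed
  then have "card {1..h} \<le> card (\<Union>i\<in>{a..<a+s}. {v \<in> {1..h}. (int v - int (c i)) mod int h \<le> int (t + a)})"
    by (intro card_mono) auto
  also have "\<dots> \<le> (\<Sum>i\<in>{a..<a+s}. card {v \<in> {1..h}. (int v - int (c i)) mod int h \<le> int (t + a)})"
    by (rule card_UN_le) simp
  also have "\<dots> \<le> (\<Sum>i\<in>{a..<a+s}. t + a + 1)"
    by (intro sum_mono card_window_le)
  finally show ?thesis by simp
qed

lemma clique_count_bound: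
  assumes "t \<ge> 1" and "h \<ge> max (t * (t + 1)) 4" and a: "a \<le> t"
    and P: "rs_partitionable (power_cycle h t) a s"
  shows "h \<le> s * (t + a + 1)"
proof (cases "3 * t + 1 \<le> h")
  case True
  then show ?thesis using a P by (rule clique_count_bound_long_cycle)
next
  case False
  have "t = 2" "h = 6"
  proof -
    have "t \<noteq> 1" using assms False by auto
    have "t < 3"
    proof (rule ccontr)
      assume "\<not> t < 3"
      then have "t * 4 \<le> t * (t + 1)" by (intro mult_le_mono2) simp
      then show False using assms(2) False \<open>\<not> t < 3\<close> by linarith
    qed
    with \<open>t \<noteq> 1\<close> assms(1) show "t = 2" by simp
    then show "h = 6" using assms(2) False by simp
  qed
  have "2 \<le> s"
  proof (rule ccontr)
    assume "\<not> 2 \<le> s"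
    \<comment> \<open>By monotonicity a partition with \<open>a \<le> 2\<close> and
      \<open>s \<le> 1\<close> would yield one of type \<open>(2, 1)\<close>.\<close>
    then have "rs_partitionable (power_cycle 6 2) 2 1"
      using P a \<open>t = 2\<close> \<open>h = 6\<close> by (auto intro: rs_partitionable_mono)
    then show False using octahedron_not_partitionable by blast
  qed
  then have "2 * (t + a + 1) \<le> s * (t + a + 1)" by (rule mult_le_mono1)
  then show ?thesis using \<open>t = 2\<close> \<open>h = 6\<close> by simp
qed

section \<open>Partitions into blocks of consecutive vertices\<close>

text \<open>
  Block \<open>k\<close> consists of the vertices \<open>b k + 1, \<dots>, b (k + 1)\<close>. Its first \<open>a\<close> vertices go to the
  \<open>a\<close> independent sets and the rest forms a clique; only the last \<open>s\<close> blocks may be longer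
  than \<open>a\<close>.
\<close>

lemma partitionable_blocks:
  assumes b: "b 0 = 0" "b l = h"
    and lower: "\<And>k. 0 < a \<Longrightarrow> k < l \<Longrightarrow> b k + (t + 1) \<le> b (Suc k)"
    and upper: "\<And>k. k < l \<Longrightarrow> b (Suc k) \<le> b k + (a + t + 1)"
    and short: "\<And>k. k < l \<Longrightarrow> b (Suc k) \<le> b k + a \<or> l \<le> k + s"
  shows "rs_partitionable (power_cycle h t) a s"
proof -
  have "\<exists>k<l. b k < v \<and> v \<le> b (Suc k)" if "v \<in> {1..h}" for v
  proof -
    have "v \<le> b l" "\<not> v \<le> b 0" using that b by auto
    then show ?thesis using ex_least_nat_less[of "\<lambda>k. v \<le> b k" l] by (meson not_le order_refl)
  qed
  then obtain K where K: "\<And>v. v \<in> {1..h} \<Longrightarrow> K v < l \<and> b (K v) < v \<and> v \<le> b (Suc (K v))"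
    by metis
  \<comment> \<open>Taking \<open>j = l\<close> also bounds the distance from the start of a block
    to the end \<open>h\<close> of the cycle.\<close>
  have gap: "b i + (t + 1) \<le> b j" if "0 < a" "i < j" "j \<le> l" for i j
    using \<open>i < j\<close> \<open>j \<le> l\<close>
  proof (induction j)
    case (Suc j)
    show ?case
    proof (cases "i = j")
      case False
      then show ?thesis using Suc lower[OF that(1), of j] by simp
    qed (use Suc lower[OF that(1), of j] in simp)
  qed simp
  \<comment> \<open>An independent colour is the position in the block, counted from 0. Clique
    colours number the blocks from the last one backwards, so that the last \<open>s\<close> blocks
    receive the colours below \<open>a + s\<close>.\<close>
  define \<kappa> where "\<kappa> v = (if v - b (K v) \<le> a then v - b (K v) - 1 else a + (l - 1 - K v))" for v
  show ?thesis
  proof (rule rs_partitionable_coloring[of _ \<kappa>])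
    fix v assume "v \<in> pverts (power_cycle h t)"
    then have "K v < l" "b (K v) < v" "v \<le> b (Suc (K v))" using K by auto
    then show "\<kappa> v < a + s"
      using short[of "K v"] by (auto simp: \<kappa>_def)
  next
    fix u v assume uv: "u \<in> pverts (power_cycle h t)" "v \<in> pverts (power_cycle h t)" "\<kappa> u = \<kappa> v"
    have Ku: "K u < l" "b (K u) < u" "u \<le> b (Suc (K u))"
      and Kv: "K v < l" "b (K v) < v" "v \<le> b (Suc (K v))"
      using K uv by auto
    show "(u, v) \<notin> parcs (power_cycle h t)" if "\<kappa> u < a"
    proof -
      \<comment> \<open>Equal colours below \<open>a\<close> mean equal positions, so the vertices
        are as far apart as the starts of their blocks. In distinct blocks \<open>gap\<close> then
        bounds both ways around the cycle, the second one through \<open>b l = h\<close>.\<close>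
      have eq: "int u - int v = int (b (K u)) - int (b (K v))"
        using that uv(3) Ku(2) Kv(2) by (auto simp: \<kappa>_def split: if_splits)
      have "0 < a" using that by simp
      note gap = gap[OF this]
      consider "K u = K v" | "K u < K v" | "K v < K u" by linarith
      then show ?thesis
      proof cases
        case 1
        then show ?thesis using eq by (simp add: power_cycle_def)
      next
        case 2
        then show ?thesis using eq gap[of "K u" "K v"] gap[of "K v" l] Kv(1) b
          by (auto simp: power_cycle_def)
      next
        case 3
        then show ?thesis using eq gap[of "K v" "K u"] gap[of "K u" l] Ku(1) b
          by (auto simp: power_cycle_def)
      qed
    qed
    show "(u, v) \<in> parcs (power_cycle h t)" if "a \<le> \<kappa> u" "u \<noteq> v"
    proof -
      have far: "\<not> u - b (K u) \<le> a" "\<not> v - b (K v) \<le> a"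
        using that(1) uv(3) Ku(2) Kv(2) by (auto simp: \<kappa>_def split: if_splits)
      then have "l - 1 - K u = l - 1 - K v" using uv(3) by (simp add: \<kappa>_def)
      then have "K u = K v" using Ku(1) Kv(1) by linarith
      \<comment> \<open>Both positions in the common block lie between \<open>a + 1\<close> and
        \<open>a + t + 1\<close>.\<close>
      then have "\<bar>int u - int v\<bar> \<le> int t"
        using far Ku Kv upper[of "K u"] by auto
      then show ?thesis using that(2) uv(1,2) by (auto simp: power_cycle_def)
    qed
  qed
qed

text \<open>The cuts at the integer parts of \<open>k * h / l\<close> give blocks whose lengths
  differ by at most one, so every bound on the average length by an integer holds for each block. If
  \<open>m \<le> a\<close> no block has vertices left for a clique; otherwise there are enough
  cliques for all \<open>l\<close> blocks.\<close>

lemma partitionable_balanced: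
  assumes l: "0 < l" and "0 < a \<Longrightarrow> l * (t + 1) \<le> h" "h \<le> l * m" "m \<le> a + t + 1"
    and "m \<le> a \<or> l \<le> s"
  shows "rs_partitionable (power_cycle h t) a s"
proof (rule partitionable_blocks[of "\<lambda>k. k * h div l" l])
  \<comment> \<open>Read from right to left, this turns bounds on block lengths into comparisons of
    dividends.\<close>
  have "(k * h + l * c) div l = k * h div l + c" for k c
    using l by simp
  note shift = this[symmetric]
  show "k * h div l + (t + 1) \<le> Suc k * h div l" if "0 < a" "k < l" for k
    unfolding shift by (rule div_le_mono) (use assms(2)[OF that(1)] in simp)
  have up: "Suc k * h div l \<le> k * h div l + m" for k
    unfolding shift by (rule div_le_mono) (use assms(3) in simp)
  show "Suc k * h div l \<le> k * h div l + (a + t + 1)" for k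
    using up[of k] assms(4) by linarith
  show "Suc k * h div l \<le> k * h div l + a \<or> l \<le> k + s" for k
    using up[of k] assms(5) by linarith
qed (use l in auto)

text \<open>All blocks have length \<open>t + 1\<close> except the last, which absorbs the remainder
  of \<open>h\<close> modulo \<open>t + 1\<close>. Its surplus of at most \<open>t\<close> vertices
  is the clique.\<close>

lemma partitionable_one_clique:
  assumes "t + 1 \<le> h"
  shows "rs_partitionable (power_cycle h t) (t + 1) 1"
proof -
  define q where "q = h div (t + 1)"
  have h: "q * (t + 1) \<le> h" "h < q * (t + 1) + (t + 1)"
    using div_times_less_eq_dividend[of h "t + 1"] dividend_less_div_times[of "t + 1" h]
    by (auto simp: q_def algebra_simps)
  have q: "0 < q" using assms by (simp add: q_def div_greater_zero_iff)
  show ?thesis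
  proof (rule partitionable_blocks[of "\<lambda>k. if k < q then k * (t + 1) else h" q])
    fix k assume "k < q"
    then have k: "Suc k < q \<or> q = Suc k" by linarith
    then show "(if k < q then k * (t + 1) else h) + (t + 1) \<le> (if Suc k < q then Suc k * (t + 1) else h)"
      using h(1) by auto
    from k show "(if Suc k < q then Suc k * (t + 1) else h)
        \<le> (if k < q then k * (t + 1) else h) + (t + 1 + t + 1)"
      using h(2) by auto
    show "(if Suc k < q then Suc k * (t + 1) else h) \<le> (if k < q then k * (t + 1) else h) + (t + 1)
        \<or> q \<le> k + 1"
      using \<open>k < q\<close> by auto
  qed (use q in auto)
qed

section \<open>The quadratic programme\<close>

lemma std_simplex_iff:
  "x \<in> std_simplex n \<longleftrightarrow> x \<in> carrier_vec n \<and> (\<forall>i<n. 0 \<le> x $ i) \<and> (\<Sum>i<n. x $ i) = 1"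
  by (auto simp: std_simplex_def less_eq_vec_def)

lemma M_K_quadratic_form:
  assumes "x \<in> carrier_vec (r + s)"
  shows "x \<bullet> (M_K r s p *\<^sub>v x) = (\<Sum>i<r+s. (if i < r then p else 1 - p) * (x $ i)\<^sup>2)"
proof -
  have "(M_K r s p *\<^sub>v x) $ i = (if i < r then p else 1 - p) * x $ i" if "i < r + s" for i
  proof -
    have "(M_K r s p *\<^sub>v x) $ i
        = (\<Sum>j<r+s. (if i = j then (if i < r then p else 1 - p) else 0) * x $ j)"
      using that carrier_vecD[OF assms] by (simp add: M_K_def scalar_prod_def atLeast0LessThan)
    also have "\<dots> = (\<Sum>j<r+s. if j = i then (if i < r then p else 1 - p) * x $ i else 0)"
      by (intro sum.cong) auto
    finally show ?thesis using that by (simp add: sum.delta)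
  qed
  then have "x $ i * (M_K r s p *\<^sub>v x) $ i = (if i < r then p else 1 - p) * (x $ i)\<^sup>2"
    if "i < r + s" for i
    using that by (simp add: power2_eq_square)
  moreover have "dim_vec (M_K r s p *\<^sub>v x) = r + s" by (simp add: M_K_def)
  ultimately show ?thesis
    unfolding scalar_prod_def atLeast0LessThan by (intro sum.cong) auto
qed

text \<open>Completing the square around the minimiser \<open>1 / (w i * W)\<close>, where
  \<open>W\<close> is the sum of the inverse weights; the linear term is fixed because the
  \<open>x i\<close> sum to 1.\<close>

lemma weighted_square_sum_ge:
  fixes w x :: "nat \<Rightarrow> real"
  assumes n: "0 < n" and w: "\<And>i. i < n \<Longrightarrow> 0 < w i" and x: "(\<Sum>i<n. x i) = 1"
  shows "1 / (\<Sum>i<n. 1 / w i) \<le> (\<Sum>i<n. w i * (x i)\<^sup>2)"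
proof -
  define W where "W = (\<Sum>i<n. 1 / w i)"
  have "0 < W" unfolding W_def using n w by (intro sum_pos) auto
  have "0 \<le> (\<Sum>i<n. w i * (x i - 1 / (w i * W))\<^sup>2)"
    using w by (intro sum_nonneg mult_nonneg_nonneg) (auto simp: less_imp_le)
  also have "\<dots> = (\<Sum>i<n. w i * (x i)\<^sup>2 - (2 / W) * x i + (1 / W\<^sup>2) * (1 / w i))"
  proof (intro sum.cong refl)
    fix i assume "i \<in> {..<n}"
    then have "0 < w i" using w by simp
    then show "w i * (x i - 1 / (w i * W))\<^sup>2 = w i * (x i)\<^sup>2 - (2 / W) * x i + (1 / W\<^sup>2) * (1 / w i)"
      using \<open>0 < W\<close> by (simp add: field_simps power2_eq_square)
  qed
  also have "\<dots> = (\<Sum>i<n. w i * (x i)\<^sup>2) - (2 / W) * (\<Sum>i<n. x i) + (1 / W\<^sup>2) * W"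
    by (simp only: sum.distrib sum_subtractf sum_distrib_left[symmetric] W_def)
  also have "\<dots> = (\<Sum>i<n. w i * (x i)\<^sup>2) - 1 / W"
    using \<open>0 < W\<close> x by (simp add: power2_eq_square)
  finally show ?thesis by (simp add: W_def)
qed

text \<open>Closed form of the minimum. The cases with a vanishing weight are split off because
  there the minimum is 0, whereas division by zero would make the corresponding summand
  vanish.\<close>

definition g_val :: "nat \<Rightarrow> nat \<Rightarrow> real \<Rightarrow> real" where
  "g_val r s p = (if p = 0 \<and> 0 < r \<or> p = 1 \<and> 0 < s then 0 else 1 / (real r / p + real s / (1 - p)))"

lemma sum_block:
  fixes a b :: real
  shows "(\<Sum>i<r+s. if i < r then a else b) = real r * a + real s * b"
proof -
  have "(\<Sum>i<r+s. if i < r then a else b) =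
      (\<Sum>i<r. if i < r then a else b) + (\<Sum>i\<in>{r..<r+s}. if i < r then a else b)"
    by (subst sum.union_disjoint[symmetric]) (auto intro!: sum.cong)
  then show ?thesis by simp
qed

lemma g_K_eq_g_val:
  assumes p: "p \<in> {0..1}" and rs: "0 < r + s"
  shows "g_K r s p = g_val r s p"
proof -
  define w where "w i = (if i < r then p else 1 - p)" for i
  define n where "n = r + s"
  have form: "x \<bullet> (M_K r s p *\<^sub>v x) = (\<Sum>i<n. w i * (x $ i)\<^sup>2)" if "x \<in> std_simplex (r + s)" for x
    using that M_K_quadratic_form[of x r s p] by (simp add: std_simplex_iff w_def n_def)
  have "(\<exists>x\<in>std_simplex n. g_val r s p = (\<Sum>i<n. w i * (x $ i)\<^sup>2)) \<and>
      (\<forall>x\<in>std_simplex n. g_val r s p \<le> (\<Sum>i<n. w i * (x $ i)\<^sup>2))"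
  proof (cases "p = 0 \<and> 0 < r \<or> p = 1 \<and> 0 < s")
    case True
    \<comment> \<open>Index 0 carries the weight \<open>p\<close> if \<open>0 < r\<close>, index
      \<open>r\<close> the weight \<open>1 - p\<close> if \<open>0 < s\<close>. All mass on such an
      index gives the value 0.\<close>
    then obtain j where j: "j < n" "w j = 0"
      by (auto simp: w_def n_def intro: that[of 0] that[of r])
    have "unit_vec n j \<in> std_simplex n"
      using j(1) by (auto simp: std_simplex_iff unit_vec_def)
    moreover have "(\<Sum>i<n. w i * (unit_vec n j $ i)\<^sup>2) = 0"
      using j by (intro sum.neutral) (auto simp: unit_vec_def)
    moreover have "0 \<le> (\<Sum>i<n. w i * (x $ i)\<^sup>2)" for x
      using p by (intro sum_nonneg mult_nonneg_nonneg) (auto simp: w_def)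
    ultimately show ?thesis using True by (auto simp: g_val_def)
  next
    case False
    then have w: "0 < w i" if "i < n" for i
      using that p by (auto simp: w_def n_def order.order_iff_strict)
    define W where "W = (\<Sum>i<n. 1 / w i)"
    have W: "0 < W" unfolding W_def using rs w by (intro sum_pos) (auto simp: n_def)
    have "W = (\<Sum>i<r+s. if i < r then 1 / p else 1 / (1 - p))"
      unfolding W_def n_def by (intro sum.cong) (auto simp: w_def)
    then have val: "g_val r s p = 1 / W"
      using False by (auto simp: g_val_def sum_block)
    \<comment> \<open>The equality case of \<open>weighted_square_sum_ge\<close>.\<close>
    define y where "y = vec n (\<lambda>i. 1 / (w i * W))"
    have "(\<Sum>i<n. y $ i) = (\<Sum>i<n. (1 / w i) * (1 / W))"
      by (intro sum.cong) (auto simp: y_def)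
    also have "\<dots> = W * (1 / W)" by (simp only: sum_distrib_right[symmetric] W_def)
    finally have "(\<Sum>i<n. y $ i) = 1" using W by simp
    then have "y \<in> std_simplex n"
      using w W by (auto simp: std_simplex_iff y_def less_imp_le)
    moreover have "1 / W = (\<Sum>i<n. w i * (y $ i)\<^sup>2)"
    proof -
      have "(\<Sum>i<n. w i * (y $ i)\<^sup>2) = (\<Sum>i<n. (1 / w i) * (1 / W\<^sup>2))"
      proof (intro sum.cong refl)
        fix i assume "i \<in> {..<n}"
        then show "w i * (y $ i)\<^sup>2 = (1 / w i) * (1 / W\<^sup>2)"
          using w[of i] W by (simp add: y_def power2_eq_square)
      qed
      also have "\<dots> = W * (1 / W\<^sup>2)" by (simp only: sum_distrib_right[symmetric] W_def)
      finally show ?thesis using W by (simp add: power2_eq_square)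
    qed
    moreover have "1 / W \<le> (\<Sum>i<n. w i * (x $ i)\<^sup>2)" if "x \<in> std_simplex n" for x
      unfolding W_def using that rs w
      by (intro weighted_square_sum_ge) (auto simp: std_simplex_iff n_def)
    ultimately show ?thesis unfolding val by blast
  qed
  then show ?thesis
    unfolding g_K_def by (intro Least_equality) (auto simp: form n_def)
qed

lemma g_val_antimono:
  assumes p: "p \<in> {0..1}" and rs: "0 < r + s" "r \<le> r'" "s \<le> s'"
  shows "g_val r' s' p \<le> g_val r s p"
proof (cases "p = 0 \<and> 0 < r' \<or> p = 1 \<and> 0 < s'")
  case True
  then show ?thesis using p by (auto simp: g_val_def)
next
  case False
  have le: "real r / p + real s / (1 - p) \<le> real r' / p + real s' / (1 - p)"
    using p rs by (intro add_mono divide_right_mono) auto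
  \<comment> \<open>Positivity is needed to invert the inequality, as
    \<open>1 / 0 = 0\<close>.\<close>
  have "0 < real r / p + real s / (1 - p)"
  proof (cases "0 < r")
    case True
    then have "0 < p" using False p rs by auto
    then show ?thesis using True p by (intro add_pos_nonneg) auto
  next
    case r: False
    then have "0 < s" using rs by simp
    then have "p < 1" using False p rs by auto
    then show ?thesis using \<open>0 < s\<close> p by (intro add_nonneg_pos) auto
  qed
  then have "1 / (real r' / p + real s' / (1 - p)) \<le> 1 / (real r / p + real s / (1 - p))"
    using le by (intro divide_left_mono mult_pos_pos) auto
  then show ?thesis using False rs by (auto simp: g_val_def)
qed

section \<open>The clique spectrum of a power of a cycle\<close>

text \<open>For \<open>0 < p < 1\<close> clear denominators; the endpoints are checked separately.
  At \<open>p = 1\<close> both sides vanish because \<open>2 \<le> ell h t a\<close> leaves at least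
  one clique.\<close>

lemma quot_term_eq_g_val:
  assumes p: "p \<in> {0..1}" and l: "2 \<le> ell h t a"
  shows "quot_term h t p a = g_val a (nat (ell h t a) - 1) p"
proof -
  define m where "m = nat (ell h t a) - 1"
  have m: "of_int (ell h t a) - 1 = real m" "0 < m" using l by (auto simp: m_def)
  consider "p = 0" | "p = 1" | "0 < p" "p < 1" using p by fastforce
  then have "quot_term h t p a = g_val a m p"
  proof cases
    case 3
    show ?thesis
    proof (cases "a = 0")
      case True
      then show ?thesis using 3 m by (simp add: quot_term_def g_val_def)
    next
      case False
      have "1 / (real a / p + real m / (1 - p)) = p * (1 - p) / (real a * (1 - p) + real m * p)"
        using 3 by (simp add: add_frac_eq)
      then show ?thesis using 3 m False by (simp add: quot_term_def g_val_def)
    qed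
  qed (use m in \<open>auto simp: quot_term_def g_val_def\<close>)
  then show ?thesis by (simp add: m_def)
qed

lemma ell_le_iff: "ell h t a \<le> int l \<longleftrightarrow> h \<le> l * (t + a + 1)"
proof -
  have "ell h t a \<le> int l \<longleftrightarrow> real h / real (t + a + 1) \<le> real l"
    by (simp add: ell_def ceiling_le_iff)
  also have "\<dots> \<longleftrightarrow> real h \<le> real (l * (t + a + 1))"
    by (simp add: pos_divide_le_eq algebra_simps)
  finally show ?thesis by (simp only: of_nat_le_iff)
qed

text \<open>The windows of \<open>t + 1\<close> consecutive vertices starting at the members of
  \<open>I\<close> are disjoint: if two of them met, their starting points would be within distance
  \<open>t\<close>. Hence \<open>(v, d) \<mapsto> v + d\<close> modulo \<open>h\<close> is
  injective.\<close>

lemma card_independent_in_power_cycle: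
  assumes I: "independent_in (power_cycle h t) I" and h: "t + 1 \<le> h"
  shows "card I * (t + 1) \<le> h"
proof -
  have sub: "I \<subseteq> {1..h}" using I by (simp add: independent_in_def)
  let ?f = "\<lambda>(v::nat, d). (int v + int d) mod int h"
  have aux: "v = v' \<and> d = d'"
    if v: "v \<in> I" "v' \<in> I" and d: "d \<le> d'" "d' \<le> t"
      and eq: "(int v + int d) mod int h = (int v' + int d') mod int h" for v v' d d' :: nat
  proof -
    have "(int v - int v') mod int h = ((int v + int d) mod int h - (int v' + int d)) mod int h"
      by (simp add: mod_diff_left_eq)
    also have "\<dots> = (int d' - int d) mod int h"
      by (simp add: eq mod_diff_left_eq)
    also have "\<dots> = int d' - int d"
      using d h by (intro mod_pos_pos_trivial) auto
    finally have m: "(int v - int v') mod int h = int d' - int d" .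
    have "v = v'"
    proof (rule ccontr)
      assume "v \<noteq> v'"
      then have "(v, v') \<in> parcs (power_cycle h t)"
        using m d v sub by (subst parcs_power_cycle_iff) auto
      then show False using I v by (simp add: independent_in_def)
    qed
    then show ?thesis using m by simp
  qed
  have "inj_on ?f (I \<times> {0..t})"
  proof (rule inj_onI)
    fix x y assume x: "x \<in> I \<times> {0..t}" and y: "y \<in> I \<times> {0..t}" and eq: "?f x = ?f y"
    obtain v d v' d' where xy: "x = (v, d)" "y = (v', d')" by fastforce
    show "x = y"
      using aux[of v v' d d'] aux[of v' v d' d] x y eq unfolding xy
      by (cases "d \<le> d'") auto
  qed
  moreover have "?f ` (I \<times> {0..t}) \<subseteq> {0..<int h}" using h by auto
  ultimately have "card (I \<times> {0..t}) \<le> card {0..<int h}" by (intro card_inj_on_le) auto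
  then show ?thesis by (simp add: card_cartesian_product)
qed

text \<open>Each of the \<open>t + 1\<close> independent sets has at most
  \<open>h div (t + 1)\<close> vertices, so covering all \<open>h\<close> vertices leaves no
  remainder.\<close>

lemma dvd_if_partitionable_independent:
  assumes "rs_partitionable (power_cycle h t) (t + 1) 0" and h: "t + 1 \<le> h"
  shows "(t + 1) dvd h"
proof -
  from assms(1) obtain A where A: "(\<Union>i\<in>{0..<t+1}. A i) = {1..h}"
      "\<forall>i\<in>{0..<t+1}. independent_in (power_cycle h t) (A i)"
    unfolding rs_partitionable_def by auto
  have "card (A i) \<le> h div (t + 1)" if "i \<in> {0..<t+1}" for i
    using card_independent_in_power_cycle[OF _ h] A(2) that
    by (simp add: less_eq_div_iff_mult_less_eq)
  then have "(\<Sum>i\<in>{0..<t+1}. card (A i)) \<le> (\<Sum>i\<in>{0..<t+1}. h div (t + 1))"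
    by (rule sum_mono)
  moreover have "card (\<Union>i\<in>{0..<t+1}. A i) \<le> (\<Sum>i\<in>{0..<t+1}. card (A i))"
    by (rule card_UN_le) simp
  ultimately have "h \<le> (t + 1) * (h div (t + 1))" unfolding A(1) by simp
  then have "h = (t + 1) * (h div (t + 1))"
    using times_div_less_eq_dividend[of "t + 1" h] by linarith
  then show ?thesis by (rule dvdI)
qed

section \<open>Maximal pairs of the clique spectrum and the resulting minimum\<close>

context
  fixes t h :: nat
  assumes t: "t \<ge> 1" and h: "h \<ge> max (t * (t + 1)) 4"
begin

text \<open>The bound \<open>4 \<le> h\<close> settles \<open>t = 1\<close>; for larger
  \<open>t\<close> the bound \<open>t * (t + 1) \<le> h\<close> suffices.\<close>

lemma two_blocks_le: "2 * (t + 1) \<le> h"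
proof (cases "t = 1")
  case False
  then have "2 * (t + 1) \<le> t * (t + 1)" using t by (intro mult_le_mono1) simp
  then show ?thesis using h by linarith
qed (use h in simp)

lemma ell_ge_2: "2 \<le> ell h t a" if "a \<le> t"
proof -
  have "\<not> ell h t a \<le> int 1"
    unfolding ell_le_iff using two_blocks_le that by simp
  then show ?thesis by simp
qed

text \<open>Since \<open>h \<ge> t * (t + 1)\<close>, the quotient is at least \<open>t\<close> and
  hence at least the remainder. The surplus vertices can be spread over the blocks of length
  \<open>t + 1\<close>, at most one to each.\<close>

lemma le_div_mult: "h \<le> h div (t + 1) * (t + 2)"
proof -
  have "t \<le> h div (t + 1)"
    using h by (subst less_eq_div_iff_mult_less_eq) auto
  moreover have "h mod (t + 1) \<le> t" using mod_less_divisor[of "t + 1" h] by linarith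
  moreover have "h = h div (t + 1) * (t + 1) + h mod (t + 1)" by (simp only: div_mult_mod_eq)
  moreover have "h div (t + 1) * (t + 2) = h div (t + 1) * (t + 1) + h div (t + 1)" by simp
  ultimately show ?thesis by linarith
qed

lemma not_partitionable_ell:
  assumes "a \<le> t"
  shows "\<not> rs_partitionable (power_cycle h t) a (nat (ell h t a) - 1)"
proof
  assume "rs_partitionable (power_cycle h t) a (nat (ell h t a) - 1)"
  then have "ell h t a \<le> int (nat (ell h t a) - 1)"
    unfolding ell_le_iff by (rule clique_count_bound[OF t h assms])
  then show False using ell_ge_2[OF assms] by linarith
qed

lemma partitionable_ell:
  assumes "a \<le> t"
  shows "rs_partitionable (power_cycle h t) a (nat (ell h t a))"
proof (rule partitionable_balanced[of "nat (ell h t a)" _ _ _ "a + t + 1"])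
  let ?l = "nat (ell h t a)"
  have l: "int ?l = ell h t a" using ell_ge_2[OF assms] by simp
  show "0 < ?l" using ell_ge_2[OF assms] by simp
  show "h \<le> ?l * (a + t + 1)"
    using ell_le_iff[of h t a ?l] l by (simp add: add.commute)
  show "?l * (t + 1) \<le> h" if "0 < a"
  proof -
    \<comment> \<open>For \<open>a \<ge> 1\<close>, blocks of length at most \<open>t + 2\<close>
      already satisfy the upper bound \<open>t + a + 1\<close>. So \<open>ell h t a\<close> is at
      most the number \<open>h div (t + 1)\<close> of such blocks, and blocks of length at least
      \<open>t + 1\<close> fit.\<close>
    have "h div (t + 1) * (t + 2) \<le> h div (t + 1) * (t + a + 1)"
      using that by (intro mult_le_mono2) simp
    then have "ell h t a \<le> int (h div (t + 1))"
      unfolding ell_le_iff using le_div_mult by linarith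
    then have "?l * (t + 1) \<le> h div (t + 1) * (t + 1)" using l by (intro mult_le_mono1) linarith
    then show ?thesis using div_times_less_eq_dividend[of h "t + 1"] by linarith
  qed
qed simp_all

lemma partitionable_independent:
  assumes "(t + 1) dvd h"
  shows "rs_partitionable (power_cycle h t) (t + 1) 0"
proof (rule partitionable_balanced[of "h div (t + 1)" _ _ _ "t + 1"])
  have "h div (t + 1) * (t + 1) = h" using assms by (rule dvd_div_mult_self)
  then show "h div (t + 1) * (t + 1) \<le> h" "h \<le> h div (t + 1) * (t + 1)" by (simp_all only: order_refl)
  show "0 < h div (t + 1)" using two_blocks_le by (simp add: div_greater_zero_iff)
qed simp_all

lemma partitionable_independent_Suc: "rs_partitionable (power_cycle h t) (t + 2) 0"
proof (rule partitionable_balanced[of "h div (t + 1)" _ _ _ "t + 2"])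
  show "0 < h div (t + 1)" using two_blocks_le by (simp add: div_greater_zero_iff)
  show "h div (t + 1) * (t + 1) \<le> h" by (rule div_times_less_eq_dividend)
qed (use le_div_mult in simp_all)

text \<open>By monotonicity a pair of the spectrum lies above none of the partitionable pairs
  \<open>(t + 2, 0)\<close>, \<open>(t + 1, 1)\<close>, \<open>(a, ell h t a)\<close> with
  \<open>a \<le> t\<close>, nor above \<open>(t + 1, 0)\<close> if \<open>t + 1\<close> divides
  \<open>h\<close>.\<close>

lemma not_partitionable_cases:
  assumes "\<not> rs_partitionable (power_cycle h t) r s"
  obtains "r \<le> t" "s \<le> nat (ell h t r) - 1" | "r = t + 1" "s = 0" "\<not> (t + 1) dvd h"
proof -
  note mono = rs_partitionable_mono[of "power_cycle h t" _ _ r s]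
  have "r < t + 2"
    using mono[OF partitionable_independent_Suc] assms by (meson le0 not_le)
  then consider "r \<le> t" | "r = t + 1" by linarith
  then show thesis
  proof cases
    case 1
    then have "s < nat (ell h t r)"
      using mono[OF partitionable_ell[OF 1]] assms by (meson order_refl not_le)
    then show ?thesis using 1 that(1) by simp
  next
    case 2
    have "rs_partitionable (power_cycle h t) (t + 1) 1"
      using two_blocks_le by (intro partitionable_one_clique) simp
    then have "s < 1" using mono 2 assms by (meson order_refl not_le)
    moreover from this have "\<not> (t + 1) dvd h" using partitionable_independent assms 2 by auto
    ultimately show ?thesis using 2 that(2) by simp
  qed
qed

lemma gamma_class_power_cycle:
  assumes p: "p \<in> {0..1}"
  shows "gamma_class (Forb (power_cycle h t)) p =
    Min ((if (t + 1) dvd h then {} else {p / real (t + 1)}) \<union> quot_term h t p ` {0..t})"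
    (is "_ = Min ?F")
proof -
  have spectrum: "clique_spectrum (Forb (power_cycle h t)) =
      {(r, s). \<not> rs_partitionable (power_cycle h t) r s}"
    by (rule clique_spectrum_Forb[OF pair_graph_power_cycle])
  have quot: "quot_term h t p a = g_K a (nat (ell h t a) - 1) p" if "a \<le> t" for a
    using quot_term_eq_g_val[OF p ell_ge_2[OF that]] g_K_eq_g_val[OF p] ell_ge_2[OF that] by simp
  have chrom: "p / real (t + 1) = g_K (t + 1) 0 p"
    using g_K_eq_g_val[OF p, of "t + 1" 0] by (simp add: g_val_def)
  have fin: "finite ?F" "?F \<noteq> {}" by auto
  have attained: "\<exists>(r, s)\<in>clique_spectrum (Forb (power_cycle h t)) - {(0, 0)}. v = g_K r s p"
    if "v \<in> ?F" for v
  proof -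
    from that consider "v = p / real (t + 1)" "\<not> (t + 1) dvd h"
      | a where "a \<le> t" "v = quot_term h t p a"
      by (auto split: if_splits)
    then show ?thesis
    proof cases
      case 1
      then have "(t + 1, 0) \<in> clique_spectrum (Forb (power_cycle h t)) - {(0, 0)}"
        using dvd_if_partitionable_independent two_blocks_le by (auto simp: spectrum)
      then show ?thesis using 1 chrom by blast
    next
      case 2
      \<comment> \<open>For \<open>a = 0\<close> the pair differs from \<open>(0, 0)\<close> because
        \<open>ell h t 0 \<ge> 2\<close>.\<close>
      then have "(a, nat (ell h t a) - 1) \<in> clique_spectrum (Forb (power_cycle h t)) - {(0, 0)}"
        using not_partitionable_ell ell_ge_2[of a] by (auto simp: spectrum)
      then show ?thesis using 2 quot by blast
    qed
  qed
  have least: "Min ?F \<le> g_K r s p"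
    if rs: "(r, s) \<in> clique_spectrum (Forb (power_cycle h t)) - {(0, 0)}" for r s
  proof -
    have pos: "0 < r + s" and "\<not> rs_partitionable (power_cycle h t) r s"
      using rs by (auto simp: spectrum)
    from this(2) show ?thesis
    proof (cases rule: not_partitionable_cases)
      case 1
      have "Min ?F \<le> quot_term h t p r" using fin(1) 1(1) by (intro Min_le) auto
      also have "\<dots> = g_val r (nat (ell h t r) - 1) p"
        by (rule quot_term_eq_g_val[OF p ell_ge_2[OF 1(1)]])
      also have "\<dots> \<le> g_val r s p" using g_val_antimono[OF p pos _ 1(2)] by simp
      finally show ?thesis by (simp add: g_K_eq_g_val[OF p pos])
    next
      case 2
      then have "Min ?F \<le> p / real (t + 1)" using fin(1) by (intro Min_le) auto
      then show ?thesis using 2 chrom by simp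
    qed
  qed
  show ?thesis
    unfolding gamma_class_def
    by (rule Least_equality) (use attained[OF Min_in[OF fin]] least in auto)
qed

end

theorem theorem2:
  fixes t h :: nat and p :: real
  assumes "t \<ge> 1" and "h \<ge> max (t * (t + 1)) 4" and "p \<in> {0..1}"
  shows "((t + 1) dvd h \<longrightarrow>
            gamma_class (Forb (power_cycle h t)) p = Min {quot_term h t p a | a. a \<in> {0..t}}) \<and>
         (\<not> (t + 1) dvd h \<longrightarrow>
            gamma_class (Forb (power_cycle h t)) p =
              Min ({p / real (t + 1)} \<union> {quot_term h t p a | a. a \<in> {0..t}}))"
proof -
  have "quot_term h t p ` {0..t} = {quot_term h t p a | a. a \<in> {0..t}}" by blast
  then show ?thesis using gamma_class_power_cycle[OF assms] by simp
qed

end
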